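(* Let $X$ be an implicative-orthomodular lattice. Then $x^*\to(x\Cap y^* )=x^*\to(x\Cap y)$ for all $x,y\in X$.
   Context: A BE algebra is an algebra $(X,\to,1)$ of type $(2,0)$ such that for all $x,y,z\in X$: $x\to x=1$; $x\to 1=1$; $1\to x=x$; $x\to(y\to z)=y\to(x\to z)$. Write $x\le y$ iff $x\to y=1$. It is bounded if there is $0\in X$ with $0\le x$ for all $x\in X$; then $x^*:=x\to 0$. A bounded BE algebra is involutive if $x^{**}=x$ for all $x$. A BE algebra is implicative if $(x\to y)\to x=x$ for all $x,y$. In an involutive BE algebra put $x\Cap y:=((x^*\to y^* )\to y^* )^*$. An implicative-orthomodular lattice is an implicative involutive BE algebra satisfying $x\Cap(y\to x)=x$ for all $x,y$. *)

theory Defs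
  imports Main
begin

locale be_algebra =
  fixes imp :: "'a \<Rightarrow> 'a \<Rightarrow> 'a"  (infixr \<open>\<rightarrow>\<close> 65)
    and one :: 'a  (\<open>\<one>\<close>)
  assumes imp_self: "x \<rightarrow> x = \<one>"
    and imp_one: "x \<rightarrow> \<one> = \<one>"
    and one_imp: "\<one> \<rightarrow> x = x"
    and imp_exchange: "x \<rightarrow> (y \<rightarrow> z) = y \<rightarrow> (x \<rightarrow> z)"

text \<open>This relation need not be antisymmetric or transitive in a general BE algebra.\<close>

definition be_le :: "('a \<Rightarrow> 'a \<Rightarrow> 'a) \<Rightarrow> 'a \<Rightarrow> 'a \<Rightarrow> 'a \<Rightarrow> bool" where
  "be_le imp one x y \<longleftrightarrow> imp x y = one"

definition be_compl :: "('a \<Rightarrow> 'a \<Rightarrow> 'a) \<Rightarrow> 'a \<Rightarrow> 'a \<Rightarrow> 'a" where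
  "be_compl imp zero x = imp x zero"

definition be_cap :: "('a \<Rightarrow> 'a \<Rightarrow> 'a) \<Rightarrow> 'a \<Rightarrow> 'a \<Rightarrow> 'a \<Rightarrow> 'a" where
  "be_cap imp zero x y =
     be_compl imp zero
       (imp (imp (be_compl imp zero x) (be_compl imp zero y)) (be_compl imp zero y))"

text \<open>
  The least element is a parameter, because the complement is defined from it.  In a
  bounded BE algebra it need not be unique; in an involutive one it is, since
  \<open>a \<rightarrow> \<zero> = \<one>\<close> gives \<open>a = (a \<rightarrow> \<zero>) \<rightarrow> \<zero> = \<one> \<rightarrow> \<zero> = \<zero>\<close>.
\<close>

locale bounded_be_algebra = be_algebra imp one
  for imp :: "'a \<Rightarrow> 'a \<Rightarrow> 'a"  (infixr \<open>\<rightarrow>\<close> 65)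
    and one :: 'a  (\<open>\<one>\<close>) +
  fixes zero :: 'a  (\<open>\<zero>\<close>)
  assumes zero_le: "be_le (\<rightarrow>) \<one> \<zero> x"

locale involutive_be_algebra = bounded_be_algebra imp one zero
  for imp :: "'a \<Rightarrow> 'a \<Rightarrow> 'a"  (infixr \<open>\<rightarrow>\<close> 65)
    and one :: 'a  (\<open>\<one>\<close>)
    and zero :: 'a  (\<open>\<zero>\<close>) +
  assumes compl_compl: "be_compl (\<rightarrow>) \<zero> (be_compl (\<rightarrow>) \<zero> x) = x"

locale implicative_be_algebra = be_algebra imp one
  for imp :: "'a \<Rightarrow> 'a \<Rightarrow> 'a"  (infixr \<open>\<rightarrow>\<close> 65)
    and one :: 'a  (\<open>\<one>\<close>) +
  assumes implicative: "(x \<rightarrow> y) \<rightarrow> x = x"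

locale implicative_orthomodular_lattice =
  involutive_be_algebra imp one zero + implicative_be_algebra imp one
  for imp :: "'a \<Rightarrow> 'a \<Rightarrow> 'a"  (infixr \<open>\<rightarrow>\<close> 65)
    and one :: 'a  (\<open>\<one>\<close>)
    and zero :: 'a  (\<open>\<zero>\<close>) +
  assumes orthomodular: "be_cap (\<rightarrow>) \<zero> x (y \<rightarrow> x) = x"

end

theory Submission
  imports Defs
begin

text \<open>
  Writing \<open>x\<^sup>\<bottom>\<close> for the complement and \<open>x \<squnion> y = x\<^sup>\<bottom> \<rightarrow> y\<close>, an implicative-orthomodular lattice
  is an orthomodular lattice in which \<open>x \<Cap> y\<close> is the Sasaki projection \<open>(x \<squnion> y\<^sup>\<bottom>) \<sqinter> y\<close>.  Both
  sides of the identity are of the form \<open>x \<squnion> ((x \<squnion> y) \<sqinter> y\<^sup>\<bottom>)\<close> up to exchanging \<open>y\<close> and \<open>y\<^sup>\<bottom>\<close>,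
  and this element equals the symmetric expression \<open>(x \<squnion> y) \<sqinter> (x \<squnion> y\<^sup>\<bottom>)\<close>: it lies below it, and
  orthomodularity shows that the relative complement vanishes.
\<close>

context implicative_orthomodular_lattice
begin

abbreviation compl :: "'a \<Rightarrow> 'a"  (\<open>_\<^sup>\<bottom>\<close> [1000] 999)
  where "x\<^sup>\<bottom> \<equiv> be_compl (\<rightarrow>) \<zero> x"

definition join :: "'a \<Rightarrow> 'a \<Rightarrow> 'a"  (infixl \<open>\<squnion>\<close> 70)
  where "x \<squnion> y = x\<^sup>\<bottom> \<rightarrow> y"

definition meet :: "'a \<Rightarrow> 'a \<Rightarrow> 'a"  (infixl \<open>\<sqinter>\<close> 75)
  where "x \<sqinter> y = (x\<^sup>\<bottom> \<squnion> y\<^sup>\<bottom>)\<^sup>\<bottom>"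

text \<open>Contraposition: the exchange law with \<open>\<zero>\<close> as the innermost
  term.\<close>

lemma imp_compl_swap: "x \<rightarrow> y\<^sup>\<bottom> = y \<rightarrow> x\<^sup>\<bottom>"
  unfolding be_compl_def by (rule imp_exchange)

lemma join_commute: "x \<squnion> y = y \<squnion> x"
  using imp_compl_swap[of "x\<^sup>\<bottom>" "y\<^sup>\<bottom>"] by (simp add: join_def compl_compl)

lemma join_left_commute: "x \<squnion> (y \<squnion> z) = y \<squnion> (x \<squnion> z)"
  unfolding join_def by (rule imp_exchange)

lemma join_assoc: "(x \<squnion> y) \<squnion> z = x \<squnion> (y \<squnion> z)"
  by (metis join_commute join_left_commute)

lemma compl_join: "(x \<squnion> y)\<^sup>\<bottom> = x\<^sup>\<bottom> \<sqinter> y\<^sup>\<bottom>"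
  by (simp add: meet_def compl_compl)

lemma compl_meet: "(x \<sqinter> y)\<^sup>\<bottom> = x\<^sup>\<bottom> \<squnion> y\<^sup>\<bottom>"
  by (simp add: meet_def compl_compl)

lemma join_meet_absorb: "x \<squnion> (x \<sqinter> y) = x"
proof -
  have "(x \<sqinter> y) \<squnion> x = (x \<rightarrow> y\<^sup>\<bottom>) \<rightarrow> x"
    by (simp add: join_def meet_def compl_compl)
  then show ?thesis
    by (simp add: implicative join_commute)
qed

lemma meet_join_absorb: "x \<sqinter> (x \<squnion> y) = x"
  using join_meet_absorb[of "x\<^sup>\<bottom>" "y\<^sup>\<bottom>"] by (metis compl_compl compl_meet compl_join)

text \<open>Follows from the two absorption laws alone: expand the second \<open>x\<close> as
  \<open>x \<sqinter> (x \<squnion> x)\<close>.\<close>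

lemma join_idem: "x \<squnion> x = x"
  by (metis join_meet_absorb meet_join_absorb)

lemma meet_commute: "x \<sqinter> y = y \<sqinter> x"
  by (simp add: meet_def join_commute)

lemma meet_assoc: "(x \<sqinter> y) \<sqinter> z = x \<sqinter> (y \<sqinter> z)"
  by (simp add: meet_def compl_compl join_assoc)

lemma meet_left_commute: "x \<sqinter> (y \<sqinter> z) = y \<sqinter> (x \<sqinter> z)"
  by (metis meet_commute meet_assoc)

lemma join_zero: "x \<squnion> \<zero> = x"
  using compl_compl[of x] by (simp add: join_def be_compl_def)

lemma meet_compl: "x \<sqinter> x\<^sup>\<bottom> = \<zero>"
proof -
  have "x \<sqinter> x\<^sup>\<bottom> = (x\<^sup>\<bottom> \<rightarrow> x\<^sup>\<bottom>)\<^sup>\<bottom>"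
    unfolding meet_def join_commute[of "x\<^sup>\<bottom>"] by (simp add: join_def compl_compl)
  then show ?thesis
    by (simp add: imp_self be_compl_def one_imp)
qed

lemma be_cap_eq: "be_cap (\<rightarrow>) \<zero> x y = (x \<squnion> y\<^sup>\<bottom>) \<sqinter> y"
  by (simp add: be_cap_def meet_def join_def compl_compl)

text \<open>Each equation expresses that \<open>x\<close> lies below \<open>y\<close> in the lattice
  order; absorption converts one into the other.\<close>

lemma join_le_meet_iff: "x \<squnion> y = y \<longleftrightarrow> x \<sqinter> y = x"
  by (metis join_commute meet_commute join_meet_absorb meet_join_absorb)

text \<open>The orthomodular axiom read through \<open>be_cap_eq\<close>: the Sasaki projection onto
  \<open>x \<squnion> y\<close> fixes \<open>y\<close>, which lies below it.\<close>

lemma orthomodular_meet: "(y \<squnion> (x \<squnion> y)\<^sup>\<bottom>) \<sqinter> (x \<squnion> y) = y"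
  using orthomodular[of y "x\<^sup>\<bottom>"] by (simp add: be_cap_eq flip: join_def)

text \<open>Dual form: complementation reverses the order, so \<open>orthomodular_meet\<close>
  applies to the complements of \<open>b\<close> and \<open>a\<close>, and complementing the result
  gives the claim.\<close>

lemma orthomodular_join:
  assumes "a \<squnion> b = b"
  shows "a \<squnion> (b \<sqinter> a\<^sup>\<bottom>) = b"
proof -
  have "a\<^sup>\<bottom> \<squnion> b\<^sup>\<bottom> = a\<^sup>\<bottom>"
    using assms by (metis compl_meet join_le_meet_iff)
  then have "(b\<^sup>\<bottom> \<squnion> a) \<sqinter> a\<^sup>\<bottom> = b\<^sup>\<bottom>"
    using orthomodular_meet[of "b\<^sup>\<bottom>" "a\<^sup>\<bottom>"] by (metis compl_compl)
  then show ?thesis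
    by (metis compl_compl compl_meet compl_join join_commute)
qed

lemma eq_if_le_and_relative_compl_zero:
  assumes "a \<squnion> b = b" "b \<sqinter> a\<^sup>\<bottom> = \<zero>"
  shows "a = b"
  using orthomodular_join[OF assms(1)] assms(2) by (simp add: join_zero)

lemma join_sasaki: "x \<squnion> ((x \<squnion> y) \<sqinter> y\<^sup>\<bottom>) = (x \<squnion> y) \<sqinter> (x \<squnion> y\<^sup>\<bottom>)"
    (is "?a = ?b")
proof (rule eq_if_le_and_relative_compl_zero)
  have "?a \<squnion> (x \<squnion> y) = x \<squnion> y"
    by (metis join_assoc join_commute join_idem join_meet_absorb)
  moreover have "?a \<squnion> (x \<squnion> y\<^sup>\<bottom>) = x \<squnion> y\<^sup>\<bottom>"
    by (metis join_assoc join_commute join_idem join_meet_absorb meet_commute)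
  \<comment> \<open>In meet form the two upper bounds combine by associativity.\<close>
  ultimately show "?a \<squnion> ?b = ?b"
    by (simp only: join_le_meet_iff flip: meet_assoc)
next
  have compl_a: "?a\<^sup>\<bottom> = x\<^sup>\<bottom> \<sqinter> (y \<squnion> (x \<squnion> y)\<^sup>\<bottom>)"
    by (simp only: compl_join[of x "_ \<sqinter> _"] compl_meet compl_compl join_commute[of y])
  \<comment> \<open>Regrouping isolates the two factors that \<open>orthomodular_meet\<close>
    collapses to \<open>y\<close>.\<close>
  have "?b \<sqinter> ?a\<^sup>\<bottom> = ((y \<squnion> (x \<squnion> y)\<^sup>\<bottom>) \<sqinter> (x \<squnion> y)) \<sqinter> (x\<^sup>\<bottom> \<sqinter> (x \<squnion> y\<^sup>\<bottom>))"
    unfolding compl_a by (simp only: meet_commute meet_left_commute meet_assoc)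
  also have "\<dots> = (x \<squnion> y\<^sup>\<bottom>) \<sqinter> (x\<^sup>\<bottom> \<sqinter> y)"
    unfolding orthomodular_meet by (simp only: meet_commute meet_left_commute meet_assoc)
  also have "\<dots> = (x \<squnion> y\<^sup>\<bottom>) \<sqinter> (x \<squnion> y\<^sup>\<bottom>)\<^sup>\<bottom>"
    by (simp only: compl_join compl_compl)
  finally show "?b \<sqinter> ?a\<^sup>\<bottom> = \<zero>"
    by (simp only: meet_compl)
qed

lemma join_be_cap:
  "x\<^sup>\<bottom> \<rightarrow> be_cap (\<rightarrow>) \<zero> x (y\<^sup>\<bottom>) = x\<^sup>\<bottom> \<rightarrow> be_cap (\<rightarrow>) \<zero> x y"
  \<comment> \<open>The two right-hand sides differ only in the order of the meet.\<close>
  using join_sasaki[of x y] join_sasaki[of x "y\<^sup>\<bottom>"]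
  by (simp add: be_cap_eq compl_compl meet_commute flip: join_def)

end

theorem proposition6p3:
  fixes imp :: "'a \<Rightarrow> 'a \<Rightarrow> 'a" and one zero :: 'a
  assumes "implicative_orthomodular_lattice imp one zero"
  shows "\<forall>x y. imp (be_compl imp zero x) (be_cap imp zero x (be_compl imp zero y))
             = imp (be_compl imp zero x) (be_cap imp zero x y)"
  using implicative_orthomodular_lattice.join_be_cap[OF assms] by blast

end
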